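(* Consider the linear quadratic difference game NZDG1 with inequality constraints described in the context, under the feasibility assumption stated there. Suppose its parameters satisfy $$[R_k^i]_{ij}=[R_k^j]_{ij},\quad i,j\in\mathcal N,\ i\ne j,\ k\in\mathcal K\setminus\{K\},$$ $$Q_k^i=Q_k^j,\quad p_k^i=p_k^j,\quad L_k^i=L_k^j,\quad [D_k^i]_{ij}=[D_k^j]_{ij},\quad i,j\in\mathcal N,\ i\neq j,\ k\in\mathcal K.$$ Then NZDG1 is an open-loop potential difference game. Further, the associated optimal control problem is the problem OCP1 (see context) with parameters described by $$Q_k=Q_k^i,\quad [D_k]_{i\bullet}=[D_k^i]_{i\bullet},\quad [d_k]_i=[d_k^i]_i,\quad L_k=L_k^i,\quad p_k=p_k^i,\quad i\in\mathcal N,\ k\in\mathcal K,$$ $$[R_k]_{i\bullet}=[R_k^i]_{i\bullet},\quad i\in\mathcal N,\ k\in\mathcal K\setminus\{K\}.$$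
   Context: Players $\mathcal N=\{1,\dots,N\}$, time periods $\mathcal K=\{0,1,\dots,K\}$. At time $k$ player $i$ chooses $u_k^i\in U_k^i\subset\mathbb R^{m_i}$ (for $k<K$) and $v_k^i\in\mathbb R^{s_i}$ (for $k\in\mathcal K$); $m=\sum_im_i$, $s=\sum_is_i$, $\mathbf u_k=(u_k^1,\dots,u_k^N)\in\mathbb R^m$, $\mathbf v_k=(v_k^1,\dots,v_k^N)\in\mathbb R^s$. Strategies are open-loop time sequences $\tilde u^i=\{u_k^i\}_{k<K}$, $\tilde v^i=\{v_k^i\}_{k\in\mathcal K}$; $-i$ denotes the players other than $i$; $\tilde{\mathbf u}=(\tilde u^i,\tilde u^{-i})$, $\tilde{\mathbf v}=(\tilde v^i,\tilde v^{-i})$. NZDG1: each player $i$ minimizes over $(\tilde u^i,\tilde v^i)$ $$J^i=\tfrac12x_K^\prime Q_K^ix_K+{p_K^i}^\prime x_K+\sum_{k=0}^{K-1}\left(\tfrac12x_k^\prime Q_k^ix_k+{p_k^i}^\prime x_k+\tfrac12\mathbf u_k^\prime R_k^i\mathbf u_k\right)+\sum_{k=0}^K\left(\tfrac12\mathbf v_k^\prime D_k^i\mathbf v_k+{d_k^i}^\prime\mathbf v_k+x_k^\prime L_k^i\mathbf v_k\right)$$ subject to $$x_{k+1}=A_kx_k+\sum_{i\in\mathcal N}B_k^iu_k^i,\ k\in\mathcal K\setminus\{K\},\ x_0\in\mathbb R^n\text{ given};\qquad M_kx_k+N_k\mathbf v_k+r_k\ge0,\ \mathbf v_k\ge0,\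 k\in\mathcal K.$$ Here $Q_k^i\in\mathbb R^{n\times n}$ and $D_k^i\in\mathbb R^{s\times s}$ are symmetric, $R_k^i\in\mathbb R^{m\times m}$ is symmetric positive definite, $p_k^i\in\mathbb R^n$, $d_k^i\in\mathbb R^s$, $L_k^i\in\mathbb R^{n\times s}$. OCP1: minimize over $(\tilde{\mathbf u},\tilde{\mathbf v})$, subject to the same dynamics and constraints, $$J=\tfrac12x_K^\prime Q_Kx_K+p_K^\prime x_K+\sum_{k=0}^{K-1}\left(\tfrac12x_k^\prime Q_kx_k+p_k^\prime x_k+\tfrac12\mathbf u_k^\prime R_k\mathbf u_k\right)+\sum_{k=0}^K\left(\tfrac12\mathbf v_k^\prime D_k\mathbf v_k+d_k^\prime\mathbf v_k+x_k^\prime L_k\mathbf v_k\right).$$ A strategy profile is admissible if $u_k^i\in U_k^i$ and the constraints hold along the generated state trajectory. An admissible $(\tilde{\mathbf u}^*,\tilde{\mathbf v}^* )$ is an open-loop Nash equilibrium if, for every $i$, $(\tilde u^{i*},\tilde v^{i*})$ minimizes $J^i$ over all $(\tilde u^i,\tilde v^i)$ for which $((\tilde u^i,\tilde u^{-i*}),(\tilde v^i,\tilde v^{-i*}))$ is admissible. The game is an open-loop potential difference game (OLPDG) if there exist instantaneous costs $P_k(x_k,\mathbf u_k,\mathbf v_k)$, $k<K$, and a terminal cost $P_K(x_K,\mathbf v_K)$ (twice continuously differentiable) such that the optimal solution of the associated optimal control problem, namely minimizing $P_K+\sum_{k<K}P_k$ over admissible profiles, is an open-loop Nash equilibrium of the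 game; the $P_k$ are then called potential functions (they are determined up to additive constants). Block notation: for a matrix $A$ with rows/columns partitioned according to the players (sizes $m_1,\dots,m_N$ for $R$, $s_1,\dots,s_N$ for $D$), $[A]_{ij}$ is the $(i,j)$ block and $[A]_{i\bullet}$ the $i$-th block row; $[a]_i$ is the $i$-th block of a vector $a$. Feasibility assumption: the sets $U_k^i$ are such that the sets $X_k$ of state vectors obtained from the dynamics are convex, and the sets $\{v_k^i\in\mathbb R^{s_i}: M_kx_k+N_k\mathbf v_k+r_k\ge0,\ \mathbf v_k\ge0\}$, $x_k\in X_k$, are non-empty, convex and bounded for all $k\in\mathcal K$, $i\in\mathcal N$. *)

theory Defs
  imports "HOL-Analysis.Analysis"
begin

text \<open>
  Index types: players \<open>'p\<close>, state coordinates \<open>'n\<close>, coordinates of the stacked controls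
  \<open>'m\<close> and \<open>'s\<close>, constraint rows \<open>'c\<close>.  The partition of \<open>\<real>^m\<close> into \<open>\<real>^m_1, \<dots>, \<real>^m_N\<close>
  is given by an owner map \<open>'m \<Rightarrow> 'p\<close>, so \<open>m_i\<close> is the cardinality of the fibre over \<open>i\<close>; likewise
  for \<open>\<real>^s\<close>.  A vector of \<open>\<real>^m_i\<close> is represented by the vector of \<open>\<real>^m\<close> that is zero
  outside block \<open>i\<close>, and a block of a matrix by the matrix that is zero outside that block.
\<close>

definition block_space :: "('a::finite \<Rightarrow> 'p) \<Rightarrow> 'p \<Rightarrow> (real ^ 'a) set" where
  "block_space own i = {z. \<forall>a. own a \<noteq> i \<longrightarrow> z $ a = 0}"

definition vec_block :: "('a::finite \<Rightarrow> 'p) \<Rightarrow> 'p \<Rightarrow> real ^ 'a \<Rightarrow> real ^ 'a" where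
  "vec_block own i z = (\<chi> a. if own a = i then z $ a else 0)"

definition mat_block ::
  "('a::finite \<Rightarrow> 'p) \<Rightarrow> 'p \<Rightarrow> 'p \<Rightarrow> real ^ 'a ^ 'a \<Rightarrow> real ^ 'a ^ 'a" where
  "mat_block own i j A = (\<chi> a b. if own a = i \<and> own b = j then A $ a $ b else 0)"

definition mat_block_row ::
  "('a::finite \<Rightarrow> 'p) \<Rightarrow> 'p \<Rightarrow> real ^ 'a ^ 'a \<Rightarrow> real ^ 'a ^ 'a" where
  "mat_block_row own i A = (\<chi> a b. if own a = i then A $ a $ b else 0)"

text \<open>\<open>replace_block own i w z\<close> is the profile \<open>(w\<^sup>i, z\<^sup>-\<^sup>i)\<close>; only block \<open>i\<close> of \<open>w\<close> matters.\<close>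

definition replace_block ::
  "('a::finite \<Rightarrow> 'p) \<Rightarrow> 'p \<Rightarrow> real ^ 'a \<Rightarrow> real ^ 'a \<Rightarrow> real ^ 'a" where
  "replace_block own i w z = (\<chi> a. if own a = i then w $ a else z $ a)"

definition symmetric_matrix :: "real ^ 'a ^ 'a \<Rightarrow> bool" where
  "symmetric_matrix A \<longleftrightarrow> transpose A = A"

definition positive_definite_matrix :: "real ^ 'a ^ 'a::finite \<Rightarrow> bool" where
  "positive_definite_matrix A \<longleftrightarrow> symmetric_matrix A \<and> (\<forall>z. z \<noteq> 0 \<longrightarrow> 0 < z \<bullet> (A *v z))"

definition twice_cont_differentiable :: "('a::real_normed_vector \<Rightarrow> real) \<Rightarrow> bool" where
  "twice_cont_differentiable f \<longleftrightarrow>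
    (\<exists>(f' :: 'a \<Rightarrow> 'a \<Rightarrow>\<^sub>L real) (f'' :: 'a \<Rightarrow> 'a \<Rightarrow>\<^sub>L ('a \<Rightarrow>\<^sub>L real)).
      (\<forall>z. (f has_derivative blinfun_apply (f' z)) (at z)) \<and>
      (\<forall>z. (f' has_derivative blinfun_apply (f'' z)) (at z)) \<and>
      continuous_on UNIV f'')"

text \<open>
  Sequences in time are functions on \<open>nat\<close>; only the values at times \<open>k < horizon\<close> (for
  \<open>u\<close>, \<open>U\<close>, \<open>A\<close>, \<open>B\<close>, \<open>R\<close>) or \<open>k \<le> horizon\<close> (for all other data) are ever used.  The matrix
  \<open>Bmat k i\<close> acts on zero-padded vectors, so only its columns owned by player \<open>i\<close> matter.
\<close>

record ('p, 'n, 'm, 's, 'c) nzdg =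
  horizon :: nat
  owner_u :: "'m \<Rightarrow> 'p"
  owner_v :: "'s \<Rightarrow> 'p"
  Uset :: "nat \<Rightarrow> 'p \<Rightarrow> (real ^ 'm) set"
  x_init :: "real ^ 'n"
  Amat :: "nat \<Rightarrow> real ^ 'n ^ 'n"
  Bmat :: "nat \<Rightarrow> 'p \<Rightarrow> real ^ 'm ^ 'n"
  Mmat :: "nat \<Rightarrow> real ^ 'n ^ 'c"
  Nmat :: "nat \<Rightarrow> real ^ 's ^ 'c"
  rvec :: "nat \<Rightarrow> real ^ 'c"
  Qmat :: "nat \<Rightarrow> 'p \<Rightarrow> real ^ 'n ^ 'n"
  pvec :: "nat \<Rightarrow> 'p \<Rightarrow> real ^ 'n"
  Rmat :: "nat \<Rightarrow> 'p \<Rightarrow> real ^ 'm ^ 'm"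
  Dmat :: "nat \<Rightarrow> 'p \<Rightarrow> real ^ 's ^ 's"
  dvec :: "nat \<Rightarrow> 'p \<Rightarrow> real ^ 's"
  Lmat :: "nat \<Rightarrow> 'p \<Rightarrow> real ^ 's ^ 'n"

definition nzdg1 ::
  "('p::finite, 'n::finite, 'm::finite, 's::finite, 'c::finite) nzdg \<Rightarrow> bool" where
  "nzdg1 G \<longleftrightarrow>
    (\<forall>k<horizon G. \<forall>i. Uset G k i \<subseteq> block_space (owner_u G) i) \<and>
    (\<forall>k<horizon G. \<forall>i. positive_definite_matrix (Rmat G k i)) \<and>
    (\<forall>k\<le>horizon G. \<forall>i. symmetric_matrix (Qmat G k i)) \<and>
    (\<forall>k\<le>horizon G. \<forall>i. symmetric_matrix (Dmat G k i))"

primrec state ::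
  "('p::finite, 'n::finite, 'm::finite, 's::finite, 'c::finite) nzdg \<Rightarrow>
    (nat \<Rightarrow> real ^ 'm) \<Rightarrow> nat \<Rightarrow> real ^ 'n" where
  "state G u 0 = x_init G"
| "state G u (Suc k) =
    Amat G k *v state G u k + (\<Sum>i\<in>UNIV. Bmat G k i *v vec_block (owner_u G) i (u k))"

text \<open>Inequalities between vectors are componentwise.\<close>

definition constraint_at ::
  "('p::finite, 'n::finite, 'm::finite, 's::finite, 'c::finite) nzdg \<Rightarrow>
    nat \<Rightarrow> real ^ 'n \<Rightarrow> real ^ 's \<Rightarrow> bool" where
  "constraint_at G k x v \<longleftrightarrow> 0 \<le> Mmat G k *v x + Nmat G k *v v + rvec G k \<and> 0 \<le> v"

definition admissible ::
  "('p::finite, 'n::finite, 'm::finite, 's::finite, 'c::finite) nzdg \<Rightarrow>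
    (nat \<Rightarrow> real ^ 'm) \<Rightarrow> (nat \<Rightarrow> real ^ 's) \<Rightarrow> bool" where
  "admissible G u v \<longleftrightarrow>
    (\<forall>k<horizon G. \<forall>i. vec_block (owner_u G) i (u k) \<in> Uset G k i) \<and>
    (\<forall>k\<le>horizon G. constraint_at G k (state G u k) (v k))"

definition reachable ::
  "('p::finite, 'n::finite, 'm::finite, 's::finite, 'c::finite) nzdg \<Rightarrow>
    nat \<Rightarrow> (real ^ 'n) set" where
  "reachable G k =
    {state G u k | u. \<forall>l<k. \<forall>i. vec_block (owner_u G) i (u l) \<in> Uset G l i}"

text \<open>The vectors \<open>v\<^sup>i\<close> that extend to some stacked vector satisfying the constraints at state \<open>x\<close>.\<close>

definition feasible_v ::
  "('p::finite, 'n::finite, 'm::finite, 's::finite, 'c::finite) nzdg \<Rightarrow>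
    nat \<Rightarrow> 'p \<Rightarrow> real ^ 'n \<Rightarrow> (real ^ 's) set" where
  "feasible_v G k i x = {vec_block (owner_v G) i v | v. constraint_at G k x v}"

definition feasibility_assumption ::
  "('p::finite, 'n::finite, 'm::finite, 's::finite, 'c::finite) nzdg \<Rightarrow> bool" where
  "feasibility_assumption G \<longleftrightarrow>
    (\<forall>k\<le>horizon G. convex (reachable G k)) \<and>
    (\<forall>k\<le>horizon G. \<forall>i. \<forall>x\<in>reachable G k.
      feasible_v G k i x \<noteq> {} \<and> convex (feasible_v G k i x) \<and> bounded (feasible_v G k i x))"

text \<open>The common form of the costs \<open>J\<^sup>i\<close> of the players and of the cost \<open>J\<close> of OCP1.\<close>

definition lq_cost ::
  "nat \<Rightarrow> (nat \<Rightarrow> real ^ 'n ^ 'n) \<Rightarrow> (nat \<Rightarrow> real ^ 'n) \<Rightarrow> (nat \<Rightarrow> real ^ 'm ^ 'm) \<Rightarrow>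
    (nat \<Rightarrow> real ^ 's ^ 's) \<Rightarrow> (nat \<Rightarrow> real ^ 's) \<Rightarrow> (nat \<Rightarrow> real ^ 's ^ 'n) \<Rightarrow>
    (nat \<Rightarrow> real ^ 'n::finite) \<Rightarrow> (nat \<Rightarrow> real ^ 'm::finite) \<Rightarrow> (nat \<Rightarrow> real ^ 's::finite) \<Rightarrow> real"
  where
  "lq_cost K Q p R D d L x u v =
    1/2 * (x K \<bullet> (Q K *v x K)) + p K \<bullet> x K
    + (\<Sum>k<K. 1/2 * (x k \<bullet> (Q k *v x k)) + p k \<bullet> x k + 1/2 * (u k \<bullet> (R k *v u k)))
    + (\<Sum>k\<le>K. 1/2 * (v k \<bullet> (D k *v v k)) + d k \<bullet> v k + x k \<bullet> (L k *v v k))"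

definition player_cost ::
  "('p::finite, 'n::finite, 'm::finite, 's::finite, 'c::finite) nzdg \<Rightarrow> 'p \<Rightarrow>
    (nat \<Rightarrow> real ^ 'm) \<Rightarrow> (nat \<Rightarrow> real ^ 's) \<Rightarrow> real" where
  "player_cost G i u v =
    lq_cost (horizon G) (\<lambda>k. Qmat G k i) (\<lambda>k. pvec G k i) (\<lambda>k. Rmat G k i)
      (\<lambda>k. Dmat G k i) (\<lambda>k. dvec G k i) (\<lambda>k. Lmat G k i) (state G u) u v"

definition open_loop_nash ::
  "('p::finite, 'n::finite, 'm::finite, 's::finite, 'c::finite) nzdg \<Rightarrow>
    (nat \<Rightarrow> real ^ 'm) \<Rightarrow> (nat \<Rightarrow> real ^ 's) \<Rightarrow> bool" where
  "open_loop_nash G us vs \<longleftrightarrow> admissible G us vs \<and>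
    (\<forall>i u v.
      let u' = (\<lambda>k. replace_block (owner_u G) i (u k) (us k));
          v' = (\<lambda>k. replace_block (owner_v G) i (v k) (vs k))
      in admissible G u' v' \<longrightarrow> player_cost G i us vs \<le> player_cost G i u' v')"

definition ocp_cost ::
  "('p::finite, 'n::finite, 'm::finite, 's::finite, 'c::finite) nzdg \<Rightarrow>
    (nat \<Rightarrow> real ^ 'n \<Rightarrow> real ^ 'm \<Rightarrow> real ^ 's \<Rightarrow> real) \<Rightarrow> (real ^ 'n \<Rightarrow> real ^ 's \<Rightarrow> real) \<Rightarrow>
    (nat \<Rightarrow> real ^ 'm) \<Rightarrow> (nat \<Rightarrow> real ^ 's) \<Rightarrow> real" where
  "ocp_cost G P PK u v =
    PK (state G u (horizon G)) (v (horizon G))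
    + (\<Sum>k<horizon G. P k (state G u k) (u k) (v k))"

definition minimizes_over_admissible ::
  "('p::finite, 'n::finite, 'm::finite, 's::finite, 'c::finite) nzdg \<Rightarrow>
    ((nat \<Rightarrow> real ^ 'm) \<Rightarrow> (nat \<Rightarrow> real ^ 's) \<Rightarrow> real) \<Rightarrow>
    (nat \<Rightarrow> real ^ 'm) \<Rightarrow> (nat \<Rightarrow> real ^ 's) \<Rightarrow> bool" where
  "minimizes_over_admissible G J us vs \<longleftrightarrow> admissible G us vs \<and>
    (\<forall>u v. admissible G u v \<longrightarrow> J us vs \<le> J u v)"

text \<open>
  Solutions of the optimal control problem need be neither unique nor existent in general, so
  the requirement is that every optimal solution is a Nash equilibrium.
\<close>

definition potential_functions ::
  "('p::finite, 'n::finite, 'm::finite, 's::finite, 'c::finite) nzdg \<Rightarrow>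
    (nat \<Rightarrow> real ^ 'n \<Rightarrow> real ^ 'm \<Rightarrow> real ^ 's \<Rightarrow> real) \<Rightarrow> (real ^ 'n \<Rightarrow> real ^ 's \<Rightarrow> real) \<Rightarrow>
    bool" where
  "potential_functions G P PK \<longleftrightarrow>
    (\<forall>k<horizon G. twice_cont_differentiable (\<lambda>(x, u, v). P k x u v)) \<and>
    twice_cont_differentiable (\<lambda>(x, v). PK x v) \<and>
    (\<forall>us vs. minimizes_over_admissible G (ocp_cost G P PK) us vs \<longrightarrow> open_loop_nash G us vs)"

definition OLPDG ::
  "('p::finite, 'n::finite, 'm::finite, 's::finite, 'c::finite) nzdg \<Rightarrow> bool" where
  "OLPDG G \<longleftrightarrow> (\<exists>P PK. potential_functions G P PK)"

record ('n, 'm, 's) ocp1 =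
  Qocp :: "nat \<Rightarrow> real ^ 'n ^ 'n"
  pocp :: "nat \<Rightarrow> real ^ 'n"
  Rocp :: "nat \<Rightarrow> real ^ 'm ^ 'm"
  Docp :: "nat \<Rightarrow> real ^ 's ^ 's"
  docp :: "nat \<Rightarrow> real ^ 's"
  Locp :: "nat \<Rightarrow> real ^ 's ^ 'n"

definition ocp1_cost ::
  "('p::finite, 'n::finite, 'm::finite, 's::finite, 'c::finite) nzdg \<Rightarrow> ('n, 'm, 's) ocp1 \<Rightarrow>
    (nat \<Rightarrow> real ^ 'm) \<Rightarrow> (nat \<Rightarrow> real ^ 's) \<Rightarrow> real" where
  "ocp1_cost G C u v =
    lq_cost (horizon G) (Qocp C) (pocp C) (Rocp C) (Docp C) (docp C) (Locp C) (state G u) u v"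

definition ocp1_terminal ::
  "('n::finite, 'm::finite, 's::finite) ocp1 \<Rightarrow> nat \<Rightarrow> real ^ 'n \<Rightarrow> real ^ 's \<Rightarrow> real" where
  "ocp1_terminal C k x v =
    1/2 * (x \<bullet> (Qocp C k *v x)) + pocp C k \<bullet> x
    + 1/2 * (v \<bullet> (Docp C k *v v)) + docp C k \<bullet> v + x \<bullet> (Locp C k *v v)"

definition ocp1_stage ::
  "('n::finite, 'm::finite, 's::finite) ocp1 \<Rightarrow>
    nat \<Rightarrow> real ^ 'n \<Rightarrow> real ^ 'm \<Rightarrow> real ^ 's \<Rightarrow> real" where
  "ocp1_stage C k x u v =
    1/2 * (x \<bullet> (Qocp C k *v x)) + pocp C k \<bullet> x + 1/2 * (u \<bullet> (Rocp C k *v u))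
    + 1/2 * (v \<bullet> (Docp C k *v v)) + docp C k \<bullet> v + x \<bullet> (Locp C k *v v)"

definition ocp1_parameters ::
  "('p::finite, 'n::finite, 'm::finite, 's::finite, 'c::finite) nzdg \<Rightarrow>
    ('n, 'm, 's) ocp1 \<Rightarrow> bool" where
  "ocp1_parameters G C \<longleftrightarrow>
    (\<forall>i. \<forall>k\<le>horizon G.
      Qocp C k = Qmat G k i \<and>
      mat_block_row (owner_v G) i (Docp C k) = mat_block_row (owner_v G) i (Dmat G k i) \<and>
      vec_block (owner_v G) i (docp C k) = vec_block (owner_v G) i (dvec G k i) \<and>
      Locp C k = Lmat G k i \<and>
      pocp C k = pvec G k i) \<and>
    (\<forall>i. \<forall>k<horizon G.
      mat_block_row (owner_u G) i (Rocp C k) = mat_block_row (owner_u G) i (Rmat G k i))"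

end

theory Submission
  imports Defs
begin

text \<open>
  The cost of OCP1 is an exact potential.  Symmetry of the matrices together with the matching
  off-diagonal blocks shows that \<open>R\<^sub>k - R\<^sub>k\<^sup>i\<close> and \<open>D\<^sub>k - D\<^sub>k\<^sup>i\<close> vanish both on the block rows and on
  the block columns of player \<open>i\<close>, and \<open>d\<^sub>k - d\<^sub>k\<^sup>i\<close> vanishes on block \<open>i\<close>.  Since all terms that
  involve the state coincide, \<open>J - J\<^sup>i\<close> does not depend on the strategy of player \<open>i\<close>, and so a
  minimizer of \<open>J\<close> admits no profitable unilateral deviation.
\<close>

section \<open>Block identities and differences of linear quadratic costs\<close>

lemma block_entries_eq:
  fixes F :: "'p \<Rightarrow> real ^ 'a::finite ^ 'a"
  assumes sym: "\<And>i. symmetric_matrix (F i)"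
    and off_diag: "\<And>i j. i \<noteq> j \<Longrightarrow> mat_block own i j (F i) = mat_block own i j (F j)"
    and rows: "\<And>i. mat_block_row own i S = mat_block_row own i (F i)"
    and ab: "own a = i \<or> own b = i"
  shows "S $ a $ b = F i $ a $ b"
proof -
  have row: "S $ a $ b = F (own a) $ a $ b"
    using arg_cong[OF rows[of "own a"], of "\<lambda>A. A $ a $ b"] by (simp add: mat_block_row_def)
  show ?thesis
  proof (cases "own a = i")
    case True
    then show ?thesis using row by simp
  next
    case False
    \<comment> \<open>Row \<open>a\<close> of \<open>S\<close> comes from the player
      \<open>own a\<close>. Here the entry lies in the off-diagonal block (\<open>own a\<close>,
      \<open>i\<close>), on which the matrices of these two players agree.\<close>
    then have "own b = i" using ab by simp
    then have "F (own a) $ a $ b = F i $ a $ b"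
      using arg_cong[OF off_diag[OF False], of "\<lambda>A. A $ a $ b"] by (simp add: mat_block_def)
    then show ?thesis using row by simp
  qed
qed

text \<open>The quadratic form of \<open>S - T\<close> has no monomial containing a coordinate of
  block \<open>i\<close>, so the content of that block is irrelevant to it.\<close>

lemma quadratic_form_diff_replace_block:
  fixes S T :: "real ^ 'a::finite ^ 'a"
  assumes "\<And>a b. own a = i \<or> own b = i \<Longrightarrow> S $ a $ b = T $ a $ b"
  shows "replace_block own i w z \<bullet> (S *v replace_block own i w z)
      - replace_block own i w z \<bullet> (T *v replace_block own i w z)
    = z \<bullet> (S *v z) - z \<bullet> (T *v z)"
proof -
  have diff: "y \<bullet> (S *v y) - y \<bullet> (T *v y)
      = (\<Sum>a\<in>UNIV. \<Sum>b\<in>UNIV. y $ a * ((S $ a $ b - T $ a $ b) * y $ b))" for y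
    by (simp add: inner_vec_def matrix_vector_mult_def sum_distrib_left sum_subtractf
        algebra_simps)
  show ?thesis
    \<comment> \<open>A summand has coefficient 0 if \<open>a\<close> or \<open>b\<close> is owned
      by \<open>i\<close>; otherwise both coordinates are left unchanged by
      \<open>replace_block\<close>.\<close>
    unfolding diff using assms
    by (intro sum.cong refl) (auto simp: replace_block_def)
qed

lemma inner_diff_replace_block:
  fixes c d :: "real ^ 'a::finite"
  assumes "vec_block own i c = vec_block own i d"
  shows "c \<bullet> replace_block own i w z - d \<bullet> replace_block own i w z = c \<bullet> z - d \<bullet> z"
proof -
  have "c $ a = d $ a" if "own a = i" for a
    using arg_cong[OF assms, of "\<lambda>y. y $ a"] that by (simp add: vec_block_def)
  then have "(c - d) \<bullet> replace_block own i w z = (c - d) \<bullet> z"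
    unfolding inner_vec_def by (intro sum.cong refl) (auto simp: replace_block_def)
  then show ?thesis by (simp add: inner_diff_left)
qed

text \<open>Both costs are evaluated along the same trajectory \<open>x\<close>, so every term
  containing \<open>x\<close> cancels, including the cross term with \<open>L\<close>. This is why
  the effect of a deviation on the trajectory never has to be tracked.\<close>

lemma lq_cost_diff:
  assumes "\<And>k. k \<le> K \<Longrightarrow> Q k = Q' k" "\<And>k. k \<le> K \<Longrightarrow> p k = p' k"
    "\<And>k. k \<le> K \<Longrightarrow> L k = L' k"
  shows "lq_cost K Q p R D d L x u v - lq_cost K Q' p' R' D' d' L' x u v
    = (\<Sum>k<K. 1/2 * (u k \<bullet> (R k *v u k) - u k \<bullet> (R' k *v u k)))
      + (\<Sum>k\<le>K. 1/2 * (v k \<bullet> (D k *v v k) - v k \<bullet> (D' k *v v k)) + (d k \<bullet> v k - d' k \<bullet> v k))"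
proof -
  have "(\<Sum>k<K. 1/2 * (x k \<bullet> (Q k *v x k)) + p k \<bullet> x k + 1/2 * (u k \<bullet> (R k *v u k)))
      - (\<Sum>k<K. 1/2 * (x k \<bullet> (Q' k *v x k)) + p' k \<bullet> x k + 1/2 * (u k \<bullet> (R' k *v u k)))
    = (\<Sum>k<K. 1/2 * (u k \<bullet> (R k *v u k) - u k \<bullet> (R' k *v u k)))"
    unfolding sum_subtractf[symmetric]
    by (intro sum.cong refl) (simp add: assms field_simps)
  moreover have
    "(\<Sum>k\<le>K. 1/2 * (v k \<bullet> (D k *v v k)) + d k \<bullet> v k + x k \<bullet> (L k *v v k))
      - (\<Sum>k\<le>K. 1/2 * (v k \<bullet> (D' k *v v k)) + d' k \<bullet> v k + x k \<bullet> (L' k *v v k))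
    = (\<Sum>k\<le>K. 1/2 * (v k \<bullet> (D k *v v k) - v k \<bullet> (D' k *v v k)) + (d k \<bullet> v k - d' k \<bullet> v k))"
    unfolding sum_subtractf[symmetric]
    by (intro sum.cong refl) (simp add: assms field_simps)
  ultimately show ?thesis
    unfolding lq_cost_def using assms[of K] by simp
qed

section \<open>Twice continuous differentiability of linear quadratic functions\<close>

lemma twice_cont_differentiableI:
  fixes f' :: "'a::real_normed_vector \<Rightarrow> 'a \<Rightarrow>\<^sub>L real"
  assumes "\<And>z. (f has_derivative blinfun_apply (f' z)) (at z)"
    and "\<And>z. (f' has_derivative blinfun_apply (f'' z)) (at z)"
    and "continuous_on UNIV f''"
  shows "twice_cont_differentiable f"
  unfolding twice_cont_differentiable_def
  by (intro exI[of _ f'] exI[of _ f''] conjI allI assms)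

lemma twice_cont_differentiable_add:
  assumes "twice_cont_differentiable f" "twice_cont_differentiable g"
  shows "twice_cont_differentiable (\<lambda>z. f z + g z)"
proof -
  obtain f' f'' where f: "\<And>z. (f has_derivative blinfun_apply (f' z)) (at z)"
      "\<And>z. (f' has_derivative blinfun_apply (f'' z)) (at z)" "continuous_on UNIV f''"
    using assms(1) unfolding twice_cont_differentiable_def by blast
  obtain g' g'' where g: "\<And>z. (g has_derivative blinfun_apply (g' z)) (at z)"
      "\<And>z. (g' has_derivative blinfun_apply (g'' z)) (at z)" "continuous_on UNIV g''"
    using assms(2) unfolding twice_cont_differentiable_def by blast
  have "((\<lambda>z. f z + g z) has_derivative blinfun_apply (f' z + g' z)) (at z)" for z
    using has_derivative_add[OF f(1) g(1)] by (simp add: plus_blinfun.rep_eq)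
  moreover have "((\<lambda>z. f' z + g' z) has_derivative blinfun_apply (f'' z + g'' z)) (at z)" for z
    using has_derivative_add[OF f(2) g(2)] by (simp add: plus_blinfun.rep_eq)
  moreover have "continuous_on UNIV (\<lambda>z. f'' z + g'' z)"
    using f(3) g(3) by (rule continuous_on_add)
  ultimately show ?thesis
    by (rule twice_cont_differentiableI)
qed

lemma twice_cont_differentiable_const: "twice_cont_differentiable (\<lambda>z. c)"
proof -
  have "((\<lambda>z. c) has_derivative blinfun_apply 0) (at z)" for z :: 'a
    by (simp add: zero_blinfun.rep_eq)
  moreover have "((\<lambda>z. 0) has_derivative blinfun_apply 0) (at z)"
    for z :: 'a
    by (simp add: zero_blinfun.rep_eq)
  ultimately show ?thesis
    using continuous_on_const by (rule twice_cont_differentiableI)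
qed

lemma twice_cont_differentiable_sum:
  assumes "\<And>a. a \<in> A \<Longrightarrow> twice_cont_differentiable (f a)"
  shows "twice_cont_differentiable (\<lambda>z. \<Sum>a\<in>A. f a z)"
  using assms
  by (induction A rule: infinite_finite_induct)
    (auto intro: twice_cont_differentiable_add twice_cont_differentiable_const)

text \<open>By the product rule the first derivative is itself linear in \<open>z\<close>; hence the
  second derivative is constant and its continuity is immediate.\<close>

lemma twice_cont_differentiable_mult_linear:
  fixes g h :: "'a::real_normed_vector \<Rightarrow> real"
  assumes "bounded_linear g" "bounded_linear h"
  shows "twice_cont_differentiable (\<lambda>z. g z * h z)"
proof -
  define f' where "f' z = g z *\<^sub>R Blinfun h + h z *\<^sub>R Blinfun g" for z
  have f': "blinfun_apply (f' z) = (\<lambda>w. g z * h w + g w * h z)" for z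
    by (simp add: f'_def plus_blinfun.rep_eq scaleR_blinfun.rep_eq
        bounded_linear_Blinfun_apply assms mult.commute)
  have lin: "bounded_linear f'"
    unfolding f'_def using assms
    by (intro bounded_linear_add bounded_linear_scaleR_const)
  have "((\<lambda>z. g z * h z) has_derivative blinfun_apply (f' z)) (at z)" for z
    unfolding f' using assms
    by (intro has_derivative_mult bounded_linear_imp_has_derivative)
  moreover have "(f' has_derivative blinfun_apply (Blinfun f')) (at z)" for z
    using lin by (simp add: bounded_linear_Blinfun_apply bounded_linear_imp_has_derivative)
  ultimately show ?thesis
    using continuous_on_const by (rule twice_cont_differentiableI)
qed

lemma twice_cont_differentiable_linear:
  fixes h :: "'a::real_normed_vector \<Rightarrow> real"
  assumes "bounded_linear h"
  shows "twice_cont_differentiable h"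
proof -
  have "(h has_derivative blinfun_apply (Blinfun h)) (at z)" for z
    using assms by (simp add: bounded_linear_Blinfun_apply bounded_linear_imp_has_derivative)
  moreover have "((\<lambda>z. Blinfun h) has_derivative blinfun_apply 0) (at z)" for z :: 'a
    by (simp add: zero_blinfun.rep_eq)
  ultimately show ?thesis
    using continuous_on_const by (rule twice_cont_differentiableI)
qed

lemma twice_cont_differentiable_inner_linear:
  fixes g h :: "'a::real_normed_vector \<Rightarrow> real ^ 'b::finite"
  assumes "bounded_linear g" "bounded_linear h"
  shows "twice_cont_differentiable (\<lambda>z. g z \<bullet> h z)"
  unfolding inner_vec_def inner_real_def
  by (intro twice_cont_differentiable_sum twice_cont_differentiable_mult_linear
      bounded_linear_compose[OF bounded_linear_vec_nth] assms)

lemma twice_cont_differentiable_cmult_inner_linear: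
  fixes g h :: "'a::real_normed_vector \<Rightarrow> real ^ 'b::finite"
  assumes "bounded_linear g" "bounded_linear h"
  shows "twice_cont_differentiable (\<lambda>z. c * (g z \<bullet> h z))"
  \<comment> \<open>The factor \<open>c\<close> is absorbed into the linear map
    \<open>g\<close>.\<close>
  using twice_cont_differentiable_inner_linear
    [OF bounded_linear_compose[OF bounded_linear_scaleR_right assms(1), of c] assms(2)]
  by simp

text \<open>Each term is a linear functional of the triple, or a constant multiple of an inner
  product of two linear images of it.\<close>

lemma twice_cont_differentiable_ocp1_stage:
  "twice_cont_differentiable (\<lambda>(x, u, v). ocp1_stage C k x u v)"
proof -
  have lin: "bounded_linear fst" "bounded_linear (\<lambda>z. fst (snd z))"
      "bounded_linear (\<lambda>z. snd (snd z))"
    by (intro bounded_linear_fst bounded_linear_snd bounded_linear_fst_comp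
        bounded_linear_snd_comp)+
  show ?thesis
    unfolding ocp1_stage_def case_prod_beta
    by (intro twice_cont_differentiable_add twice_cont_differentiable_cmult_inner_linear
        twice_cont_differentiable_inner_linear lin
        bounded_linear_compose[OF matrix_vector_mul_bounded_linear]
        twice_cont_differentiable_linear bounded_linear_compose[OF bounded_linear_inner_right])
qed

lemma twice_cont_differentiable_ocp1_terminal:
  "twice_cont_differentiable (\<lambda>(x, v). ocp1_terminal C k x v)"
  unfolding ocp1_terminal_def case_prod_beta
  by (intro twice_cont_differentiable_add twice_cont_differentiable_cmult_inner_linear
      twice_cont_differentiable_inner_linear bounded_linear_fst bounded_linear_snd
      bounded_linear_compose[OF matrix_vector_mul_bounded_linear]
      twice_cont_differentiable_linear bounded_linear_compose[OF bounded_linear_inner_right])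

section \<open>OCP1 as the associated optimal control problem\<close>

lemma ocp_cost_ocp1:
  "ocp_cost G (ocp1_stage C) (ocp1_terminal C (horizon G)) u v = ocp1_cost G C u v"
  \<comment> \<open>The sum over \<open>v\<close> in \<open>lq_cost\<close> runs up to the horizon.
    Its last term is split off into the terminal cost, and the others join the stage costs.\<close>
  unfolding ocp_cost_def ocp1_cost_def lq_cost_def ocp1_stage_def ocp1_terminal_def
    lessThan_Suc_atMost[symmetric] sum.lessThan_Suc
  by (simp add: sum.distrib)

text \<open>This keeps the claim about all parameter sets \<open>C\<close> from being vacuous and
  provides the witness for \<open>OLPDG\<close>.\<close>

lemma ocp1_parameters_exist:
  assumes "\<And>i j k. k \<le> horizon G \<Longrightarrow>
    Qmat G k i = Qmat G k j \<and> pvec G k i = pvec G k j \<and> Lmat G k i = Lmat G k j"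
  shows "\<exists>C. ocp1_parameters G C"
proof -
  \<comment> \<open>Any player serves as \<open>j\<close>, since \<open>Q\<close>, \<open>p\<close>
    and \<open>L\<close> are common to all. The remaining data are glued row by row: index
    \<open>a\<close> takes its row or entry from the player owning \<open>a\<close>.\<close>
  define j :: 'a where "j = undefined"
  define C where "C = \<lparr>Qocp = (\<lambda>k. Qmat G k j), pocp = (\<lambda>k. pvec G k j),
    Rocp = (\<lambda>k. \<chi> a. Rmat G k (owner_u G a) $ a),
    Docp = (\<lambda>k. \<chi> a. Dmat G k (owner_v G a) $ a),
    docp = (\<lambda>k. \<chi> a. dvec G k (owner_v G a) $ a), Locp = (\<lambda>k. Lmat G k j)\<rparr>"
  have "ocp1_parameters G C"
    using assms unfolding ocp1_parameters_def C_def
    by (auto simp: mat_block_row_def vec_block_def vec_eq_iff)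
  then show ?thesis by blast
qed

theorem theorem4p2:
  fixes G :: "('p::finite, 'n::finite, 'm::finite, 's::finite, 'c::finite) nzdg"
  assumes "nzdg1 G"
    and "feasibility_assumption G"
    and "\<And>i j k. i \<noteq> j \<Longrightarrow> k < horizon G \<Longrightarrow>
      mat_block (owner_u G) i j (Rmat G k i) = mat_block (owner_u G) i j (Rmat G k j)"
    and "\<And>i j k. i \<noteq> j \<Longrightarrow> k \<le> horizon G \<Longrightarrow>
      Qmat G k i = Qmat G k j \<and> pvec G k i = pvec G k j \<and> Lmat G k i = Lmat G k j \<and>
      mat_block (owner_v G) i j (Dmat G k i) = mat_block (owner_v G) i j (Dmat G k j)"
  shows "OLPDG G \<and>
    (\<exists>C. ocp1_parameters G C) \<and>
    (\<forall>C. ocp1_parameters G C \<longrightarrow>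
      potential_functions G (ocp1_stage C) (ocp1_terminal C (horizon G)) \<and>
      (\<forall>u v. ocp_cost G (ocp1_stage C) (ocp1_terminal C (horizon G)) u v = ocp1_cost G C u v))"
proof -
  have common: "Qmat G k i = Qmat G k j \<and> pvec G k i = pvec G k j \<and> Lmat G k i = Lmat G k j"
    if "k \<le> horizon G" for i j k
    using assms(4)[of i j k] that by (cases "i = j") auto
  have potential: "potential_functions G (ocp1_stage C) (ocp1_terminal C (horizon G))"
    if C: "ocp1_parameters G C" for C
  proof -
    have Req: "Rocp C k $ a $ b = Rmat G k i $ a $ b"
      if k: "k < horizon G" and ab: "owner_u G a = i \<or> owner_u G b = i" for k a b i
    proof (rule block_entries_eq[where F = "Rmat G k" and own = "owner_u G", OF _ _ _ ab])
      show "symmetric_matrix (Rmat G k i)" for i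
        using assms(1) k by (simp add: nzdg1_def positive_definite_matrix_def)
      show "mat_block_row (owner_u G) i (Rocp C k) = mat_block_row (owner_u G) i (Rmat G k i)"
        for i
        using C k by (simp add: ocp1_parameters_def)
    qed (rule assms(3)[OF _ k])
    have Deq: "Docp C k $ a $ b = Dmat G k i $ a $ b"
      if k: "k \<le> horizon G" and ab: "owner_v G a = i \<or> owner_v G b = i" for k a b i
    proof (rule block_entries_eq[where F = "Dmat G k" and own = "owner_v G", OF _ _ _ ab])
      show "symmetric_matrix (Dmat G k i)" for i
        using assms(1) k by (simp add: nzdg1_def)
      show "mat_block_row (owner_v G) i (Docp C k) = mat_block_row (owner_v G) i (Dmat G k i)"
        for i
        using C k by (simp add: ocp1_parameters_def)
    qed (use assms(4) k in blast)
    have deq: "vec_block (owner_v G) i (docp C k) = vec_block (owner_v G) i (dvec G k i)"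
      if "k \<le> horizon G" for k i
      using C that by (simp add: ocp1_parameters_def)
    \<comment> \<open>These are the unilateral deviations quantified over in
      \<open>open_loop_nash\<close>.\<close>
    define dev_u where "dev_u i u us = (\<lambda>k. replace_block (owner_u G) i (u k) (us k))"
      for i and u us :: "nat \<Rightarrow> real ^ 'm"
    define dev_v where "dev_v i v vs = (\<lambda>k. replace_block (owner_v G) i (v k) (vs k))"
      for i and v vs :: "nat \<Rightarrow> real ^ 's"
    \<comment> \<open>No state occurs on the right: the gap between potential and player cost is a
      function of \<open>u\<close> and \<open>v\<close> alone.\<close>
    have gap: "ocp1_cost G C u v - player_cost G i u v
      = (\<Sum>k<horizon G. 1/2 * (u k \<bullet> (Rocp C k *v u k) - u k \<bullet> (Rmat G k i *v u k)))
        + (\<Sum>k\<le>horizon G. 1/2 * (v k \<bullet> (Docp C k *v v k) - v k \<bullet> (Dmat G k i *v v k))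
            + (docp C k \<bullet> v k - dvec G k i \<bullet> v k))" for i u v
      unfolding ocp1_cost_def player_cost_def
      by (rule lq_cost_diff) (use C in \<open>simp_all add: ocp1_parameters_def\<close>)
    \<comment> \<open>Exact potential identity: none of the forms in the gap involves a coordinate
      owned by \<open>i\<close>. It holds for all deviations, admissible or not.\<close>
    have exact: "ocp1_cost G C (dev_u i u us) (dev_v i v vs)
        - player_cost G i (dev_u i u us) (dev_v i v vs)
      = ocp1_cost G C us vs - player_cost G i us vs" for i u v us vs
      unfolding gap dev_u_def dev_v_def
      by (intro arg_cong2[where f = "(+)"] arg_cong2[where f = "(*)"] sum.cong refl
          quadratic_form_diff_replace_block inner_diff_replace_block Req Deq deq) auto
    have "open_loop_nash G us vs"
      if min: "minimizes_over_admissible G (ocp1_cost G C) us vs" for us vs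
    proof -
      have "player_cost G i us vs \<le> player_cost G i (dev_u i u us) (dev_v i v vs)"
        if "admissible G (dev_u i u us) (dev_v i v vs)" for i u v
      proof -
        \<comment> \<open>An admissible unilateral deviation is a competitor in the joint problem.
          Subtracting the common gap then turns optimality into the Nash inequality.\<close>
        have "ocp1_cost G C us vs \<le> ocp1_cost G C (dev_u i u us) (dev_v i v vs)"
          using min that by (simp add: minimizes_over_admissible_def)
        then show ?thesis using exact[of i u us v vs] by simp
      qed
      then show ?thesis
        using min by (simp add: open_loop_nash_def minimizes_over_admissible_def Let_def
            dev_u_def dev_v_def)
    qed
    then show ?thesis
      unfolding potential_functions_def ocp_cost_ocp1
      using twice_cont_differentiable_ocp1_stage twice_cont_differentiable_ocp1_terminal by blast
  qed
  have "\<exists>C. ocp1_parameters G C"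
    using common by (rule ocp1_parameters_exist)
  with potential show ?thesis
    unfolding OLPDG_def using ocp_cost_ocp1 by blast
qed

end
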